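(* Let $\mathcal{H}$ be a separable complex Hilbert space and let $A$ be a bounded linear operator on $\mathcal{H}$. If $A$ is a contraction (i.e., $\|A\|\le 1$) and for every $f\in\mathcal{H}$, $(A^* )^n f\to 0$ (in norm) as $n\to\infty$, then there exists a set $G\subseteq\mathcal{H}$ such that the system $\{A^n g\}_{g\in G,\, n\ge 0}$ is a tight frame in $\mathcal{H}$.
   Context: The system $\{A^n g\}_{g\in G,\,n\ge 0}$ is regarded as a family indexed by pairs $(g,n)$ with $g\in G$, $n\in\{0,1,2,\dots\}$. It is a tight frame in $\mathcal{H}$ if there is a constant $C>0$ such that $\sum_{g\in G}\sum_{n=0}^\infty |\langle f, A^n g\rangle|^2 = C\|f\|^2$ for all $f\in\mathcal{H}$. $A^*$ denotes the adjoint of $A$. *)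

theory Defs
  imports "HOL-Analysis.Analysis"
begin

class complex_vector = real_vector +
  fixes scaleC :: "complex \<Rightarrow> 'a \<Rightarrow> 'a"  (infixr "*\<^sub>C" 75)
  assumes scaleC_add_right: "a *\<^sub>C (x + y) = a *\<^sub>C x + a *\<^sub>C y"
    and scaleC_add_left: "(a + b) *\<^sub>C x = a *\<^sub>C x + b *\<^sub>C x"
    and scaleC_scaleC: "a *\<^sub>C (b *\<^sub>C x) = (a * b) *\<^sub>C x"
    and scaleR_scaleC: "r *\<^sub>R x = complex_of_real r *\<^sub>C x"

lemma scaleC_one: "1 *\<^sub>C x = (x :: 'a::complex_vector)"
  using scaleR_scaleC[of 1 x] by simp

text \<open>
  Sesquilinear forms are linear in the first argument.  The norm, and definiteness of
  \<open>cinner\<close>, come from the underlying real inner product \<open>Re (cinner x y)\<close>; see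
  \<open>cinner_self\<close> below.
\<close>

class complex_inner = complex_vector + real_inner +
  fixes cinner :: "'a \<Rightarrow> 'a \<Rightarrow> complex"
  assumes cinner_commute: "cinner x y = cnj (cinner y x)"
    and cinner_add_left: "cinner (x + y) z = cinner x z + cinner y z"
    and cinner_scaleC_left: "cinner (a *\<^sub>C x) y = a * cinner x y"
    and inner_eq_Re_cinner: "inner x y = Re (cinner x y)"

lemma cinner_self: "cinner x x = complex_of_real ((norm x)\<^sup>2)"
proof (rule complex_eqI)
  show "Re (cinner x x) = Re (complex_of_real ((norm x)\<^sup>2))"
    by (simp add: power2_norm_eq_inner inner_eq_Re_cinner)
  have "Im (cinner x x) = - Im (cinner x x)"
    using arg_cong[OF cinner_commute[of x x], of Im] by simp
  then show "Im (cinner x x) = Im (complex_of_real ((norm x)\<^sup>2))"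
    by simp
qed

class chilbert_space = complex_inner + complete_space

definition bounded_clinear :: "('a::complex_inner \<Rightarrow> 'b::complex_inner) \<Rightarrow> bool" where
  "bounded_clinear A \<longleftrightarrow> bounded_linear A \<and> (\<forall>c x. A (c *\<^sub>C x) = c *\<^sub>C A x)"

text \<open>
  Meaningful for bounded operators between Hilbert spaces, where the Riesz representation
  theorem gives existence and uniqueness.
\<close>

definition cadjoint :: "('a::chilbert_space \<Rightarrow> 'b::chilbert_space) \<Rightarrow> 'b \<Rightarrow> 'a" where
  "cadjoint A = (THE B. \<forall>x y. cinner (A x) y = cinner x (B y))"

text \<open>
  The frame is a family indexed by \<open>I\<close>, so repeated vectors count with multiplicity.
\<close>

definition tight_frame :: "'i set \<Rightarrow> ('i \<Rightarrow> 'a::chilbert_space) \<Rightarrow> bool" where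
  "tight_frame I \<phi> \<longleftrightarrow>
     (\<exists>C>0. \<forall>f. ((\<lambda>i. (cmod (cinner f (\<phi> i)))\<^sup>2) has_sum C * (norm f)\<^sup>2) I)"

end

theory Submission
  imports Defs
begin

text \<open>
  Put \<open>T = I - A A\<^sup>*\<close>.  Since \<open>A\<close> is a contraction,
  \<open>\<langle>T f, f\<rangle> = \<parallel>f\<parallel>\<^sup>2 - \<parallel>A\<^sup>* f\<parallel>\<^sup>2 \<ge> 0\<close>.  Suppose that a set \<open>G\<close> satisfies
  \<open>\<Sum>\<^sub>g |\<langle>f, g\<rangle>|\<^sup>2 = \<langle>T f, f\<rangle>\<close> for all \<open>f\<close>.  Because \<open>\<langle>f, A\<^sup>n g\<rangle> = \<langle>(A\<^sup>*)\<^sup>n f, g\<rangle>\<close>,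
  the sum over \<open>g\<close> at level \<open>n\<close> is then
  \<open>\<parallel>(A\<^sup>*)\<^sup>n f\<parallel>\<^sup>2 - \<parallel>(A\<^sup>*)\<^sup>n\<^sup>+\<^sup>1 f\<parallel>\<^sup>2\<close>, and the sum over \<open>n\<close> telescopes to \<open>\<parallel>f\<parallel>\<^sup>2\<close>
  since \<open>(A\<^sup>*)\<^sup>n f \<rightarrow> 0\<close>.  So the frame is tight with constant \<open>1\<close>.

  The usual choice of \<open>G\<close> consists of the images of an orthonormal basis under the square root
  of \<open>T\<close>.  Two basis vectors may have the same image, however, and a set would lose that
  multiplicity.  The set is therefore built by a Cholesky decomposition of \<open>T\<close>
  (\<open>positive_operator_rank_one_decomposition\<close>): run through a dense sequence \<open>x\<^sub>0, x\<^sub>1, \<dots>\<close>, and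
  in step \<open>n\<close> subtract from the current remainder the rank-one operator of a vector \<open>g\<^sub>n\<close> chosen
  such that the new remainder is still positive and annihilates \<open>x\<^sub>n\<close>.  The
  remainders decrease to \<open>0\<close> on a dense set, hence everywhere.  Moreover \<open>g\<^sub>n\<close> is orthogonal to
  every earlier \<open>x\<^sub>m\<close> with \<open>g\<^sub>m \<noteq> 0\<close>, whereas \<open>g\<^sub>m\<close> itself is not, so the nonzero \<open>g\<^sub>n\<close> are pairwise
  distinct and form a set without loss.

  The defining property of the adjoint rests on the Riesz representation theorem
  (\<open>real_riesz_representation\<close>, \<open>cinner_cadjoint\<close>).
\<close>

section \<open>Sesquilinear algebra\<close>

lemma cinner_add_right: "cinner x (y + z) = cinner x y + cinner x z"
  by (metis cinner_add_left cinner_commute complex_cnj_add)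

lemma cinner_scaleC_right: "cinner x (a *\<^sub>C y) = cnj a * cinner x y"
  by (metis cinner_scaleC_left cinner_commute complex_cnj_mult)

lemma cinner_diff_left: "cinner (x - y) z = cinner x z - cinner y z"
  using cinner_add_left[of "x - y" y z] by simp

lemma cinner_diff_right: "cinner x (y - z) = cinner x y - cinner x z"
  using cinner_add_right[of x "y - z" z] by simp

lemma cinner_zero_left [simp]: "cinner 0 x = 0"
  using cinner_diff_left[of 0 0 x] by simp

lemma cinner_zero_right [simp]: "cinner x 0 = 0"
  using cinner_diff_right[of x 0 0] by simp

lemmas cinner_simps =
  cinner_add_left cinner_add_right cinner_diff_left cinner_diff_right
  cinner_scaleC_left cinner_scaleC_right

lemma scaleC_zero_left [simp]: "0 *\<^sub>C x = (0 :: 'a::complex_vector)"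
  using scaleR_scaleC[of 0 x] by simp

lemma cinner_extensionality:
  assumes "\<And>z. cinner z x = cinner z y"
  shows "x = y"
proof -
  have "cinner (x - y) (x - y) = 0"
    using assms by (simp add: cinner_diff_right)
  then show ?thesis by (simp add: cinner_self)
qed

section \<open>Riesz representation and adjoints\<close>

text \<open>
  The representing vector is the minimiser of \<open>J x = \<parallel>x\<parallel>\<^sup>2 - 2 l x\<close>: the parallelogram law makes
  every minimising sequence Cauchy, and at the minimiser the directional derivatives
  \<open>2 (\<langle>u, v\<rangle> - l v)\<close> vanish.
\<close>

theorem real_riesz_representation:
  fixes l :: "'a::{real_inner, complete_space} \<Rightarrow> real"
  assumes "bounded_linear l"
  shows "\<exists>u. \<forall>v. inner u v = l v"
proof -
  interpret l: bounded_linear l by fact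
  define J where "J x = (norm x)\<^sup>2 - 2 * l x" for x
  obtain K where K: "\<And>x. norm (l x) \<le> norm x * K"
    using l.bounded by blast
  have J_lower: "J x \<ge> - K\<^sup>2" for x
  proof -
    have "0 \<le> (norm x - K)\<^sup>2" by simp
    moreover have "l x \<le> norm x * K" using K[of x] by simp
    ultimately show ?thesis by (simp add: J_def power2_diff)
  qed
  define m where "m = Inf (range J)"
  have bdd: "bdd_below (range J)"
    using J_lower by (auto intro!: bdd_belowI[of _ "- K\<^sup>2"])
  have m_le: "m \<le> J x" for x
    unfolding m_def by (rule cInf_lower[OF _ bdd]) simp
  have "\<exists>x. J x < m + 1 / real (Suc n)" for n
    using cInf_lessD[of "range J" "m + 1 / real (Suc n)"] by (auto simp: m_def)
  then obtain X where X: "\<And>n. J (X n) < m + 1 / real (Suc n)" by metis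
  have midpoint: "(norm (x - y))\<^sup>2 \<le> 2 * (J x + J y - 2 * m)" for x y
  proof -
    have "(norm (x - y))\<^sup>2 = 2 * (J x + J y - 2 * J ((1/2) *\<^sub>R (x + y)))"
      unfolding J_def power2_norm_eq_inner
      by (simp add: l.scaleR l.add inner_simps inner_commute field_simps)
    then show ?thesis using m_le[of "(1/2) *\<^sub>R (x + y)"] by simp
  qed
  have "Cauchy X"
  proof (rule metric_CauchyI)
    fix e :: real assume "e > 0"
    then obtain N where N: "inverse (real (Suc N)) < e\<^sup>2 / 4"
      using reals_Archimedean[of "e\<^sup>2 / 4"] by auto
    have "dist (X i) (X j) < e" if "i \<ge> N" "j \<ge> N" for i j
    proof -
      have small: "J (X k) < m + e\<^sup>2 / 4" if "k \<ge> N" for k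
      proof -
        have "1 / real (Suc k) \<le> 1 / real (Suc N)"
          using that by (intro divide_left_mono) auto
        then show ?thesis using X[of k] N by (simp add: inverse_eq_divide)
      qed
      have "(norm (X i - X j))\<^sup>2 < e\<^sup>2"
        using midpoint[of "X i" "X j"] small[OF that(1)] small[OF that(2)] by simp
      then show ?thesis
        using \<open>e > 0\<close> by (simp add: dist_norm power_less_imp_less_base)
    qed
    then show "\<exists>N. \<forall>i\<ge>N. \<forall>j\<ge>N. dist (X i) (X j) < e" by blast
  qed
  then obtain u where u: "X \<longlonglongrightarrow> u"
    using Cauchy_convergent convergent_def by blast
  have "(\<lambda>n. J (X n)) \<longlonglongrightarrow> J u"
    unfolding J_def by (intro tendsto_intros u l.tendsto)
  moreover have "(\<lambda>n. m + 1 / real (Suc n)) \<longlonglongrightarrow> m + 0"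
    using LIMSEQ_inverse_real_of_nat by (intro tendsto_intros) (simp add: inverse_eq_divide)
  ultimately have "J u \<le> m"
    using X by (intro LIMSEQ_le[of "\<lambda>n. J (X n)" _ "\<lambda>n. m + 1 / real (Suc n)"])
      (auto intro: less_imp_le)
  then have min: "J u \<le> J x" for x using m_le[of x] by simp
  have "inner u v = l v" for v
  proof (cases "v = 0")
    case True
    then show ?thesis by (simp add: l.zero)
  next
    case False
    define s where "s = inner u v - l v"
    \<comment> \<open>The vertex of the parabola \<open>t \<mapsto> J (u + t v)\<close>.\<close>
    define t where "t = - s / (norm v)\<^sup>2"
    have "J (u + t *\<^sub>R v) = J u + 2 * t * s + t\<^sup>2 * (norm v)\<^sup>2"
      unfolding J_def s_def power2_norm_eq_inner
      by (simp add: l.scaleR l.add inner_simps inner_commute power2_eq_square algebra_simps)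
    also have "\<dots> = J u - s\<^sup>2 / (norm v)\<^sup>2"
      using False by (simp add: t_def power2_eq_square field_simps)
    finally have "s\<^sup>2 / (norm v)\<^sup>2 \<le> 0" using min[of "u + t *\<^sub>R v"] by simp
    then have "s = 0" using False by (simp add: divide_le_0_iff)
    then show ?thesis by (simp add: s_def)
  qed
  then show ?thesis by blast
qed

text \<open>
  Real parts come from the real Riesz theorem; imaginary parts follow by replacing \<open>x\<close> with
  \<open>\<i> x\<close>, as both sides are complex linear in \<open>x\<close>.
\<close>

theorem cinner_cadjoint:
  fixes A :: "'a::chilbert_space \<Rightarrow> 'b::chilbert_space"
  assumes "bounded_clinear A"
  shows "cinner (A x) y = cinner x (cadjoint A y)"
proof -
  have bl: "bounded_linear A" and hom: "\<And>c x. A (c *\<^sub>C x) = c *\<^sub>C A x"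
    using assms by (auto simp: bounded_clinear_def)
  have "\<exists>u. \<forall>x. cinner (A x) y = cinner x u" for y
  proof -
    have "bounded_linear (\<lambda>x. inner (A x) y)"
      using bounded_linear_compose[OF bounded_linear_inner_left bl] .
    then obtain u where "\<And>x. inner u x = inner (A x) y"
      using real_riesz_representation by blast
    then have Re_eq: "Re (cinner x u) = Re (cinner (A x) y)" for x
      unfolding inner_eq_Re_cinner[symmetric] by (subst inner_commute)
    have "Im (cinner x u) = Im (cinner (A x) y)" for x
      using Re_eq[of "\<i> *\<^sub>C x"] by (simp add: hom cinner_scaleC_left)
    with Re_eq show ?thesis by (metis complex_eqI)
  qed
  then obtain B where B: "\<And>x y. cinner (A x) y = cinner x (B y)" by metis
  have "cadjoint A = B"
    unfolding cadjoint_def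
  proof (rule the_equality)
    show "\<forall>x y. cinner (A x) y = cinner x (B y)" using B by blast
  next
    fix B' assume "\<forall>x y. cinner (A x) y = cinner x (B' y)"
    then show "B' = B" using B by (metis cinner_extensionality ext)
  qed
  with B show ?thesis by simp
qed

lemma cinner_funpow_cadjoint:
  fixes A :: "'a::chilbert_space \<Rightarrow> 'a"
  assumes "bounded_clinear A"
  shows "cinner ((A ^^ n) x) y = cinner x ((cadjoint A ^^ n) y)"
proof (induction n arbitrary: y)
  case (Suc n)
  have "cinner ((A ^^ Suc n) x) y = cinner ((A ^^ n) x) (cadjoint A y)"
    by (simp add: cinner_cadjoint[OF assms])
  also have "\<dots> = cinner x ((cadjoint A ^^ Suc n) y)"
    by (simp add: Suc.IH funpow_swap1)
  finally show ?case .
qed simp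

lemma norm_cadjoint_le:
  fixes A :: "'a::chilbert_space \<Rightarrow> 'b::chilbert_space"
  assumes "bounded_clinear A" and "onorm A \<le> 1"
  shows "norm (cadjoint A y) \<le> norm y"
proof -
  have bl: "bounded_linear A" using assms(1) by (simp add: bounded_clinear_def)
  have contr: "norm (A x) \<le> norm x" for x
    using onorm[OF bl, of x] mult_right_mono[OF assms(2), of "norm x"] by simp
  have "(norm (cadjoint A y))\<^sup>2 = inner (A (cadjoint A y)) y"
    using cinner_cadjoint[OF assms(1), of "cadjoint A y" y]
    by (simp add: inner_eq_Re_cinner cinner_self)
  also have "\<dots> \<le> norm (cadjoint A y) * norm y"
    using norm_cauchy_schwarz[of "A (cadjoint A y)" y]
      mult_right_mono[OF contr[of "cadjoint A y"], of "norm y"] by simp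
  finally have "norm (cadjoint A y) * norm (cadjoint A y) \<le> norm (cadjoint A y) * norm y"
    by (simp add: power2_eq_square)
  then show ?thesis
    by (cases "norm (cadjoint A y) = 0") simp_all
qed

section \<open>Cholesky decomposition of positive operators\<close>

text \<open>
  Linearity is not part of the definition because symmetry implies it: an identity for \<open>T\<close> can be
  tested against arbitrary vectors, and symmetry moves \<open>T\<close> to the other side.
\<close>

definition positive_operator :: "('a::complex_inner \<Rightarrow> 'a) \<Rightarrow> bool" where
  "positive_operator T \<longleftrightarrow>
     (\<forall>x y. cinner (T x) y = cinner x (T y)) \<and> (\<forall>x. 0 \<le> Re (cinner (T x) x))"

text \<open>
  If \<open>\<langle>T x, x\<rangle> = 0\<close>, division by zero makes the pivot \<open>0\<close>, so that deflation
  leaves \<open>T\<close> unchanged and needs no separate case.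
\<close>

definition pivot :: "('a::complex_inner \<Rightarrow> 'a) \<Rightarrow> 'a \<Rightarrow> 'a" where
  "pivot T x = complex_of_real (1 / sqrt (Re (cinner (T x) x))) *\<^sub>C T x"

definition deflate :: "('a::complex_inner \<Rightarrow> 'a) \<Rightarrow> 'a \<Rightarrow> 'a \<Rightarrow> 'a" where
  "deflate T x f = T f - cinner f (pivot T x) *\<^sub>C pivot T x"

lemma positive_operator_sym:
  "positive_operator T \<Longrightarrow> cinner (T x) y = cinner x (T y)"
  by (simp add: positive_operator_def)

lemma positive_operator_nonneg:
  "positive_operator T \<Longrightarrow> 0 \<le> Re (cinner (T x) x)"
  unfolding positive_operator_def by blast

lemma positive_operator_diag:
  assumes "positive_operator T"
  shows "cinner (T x) x = complex_of_real (Re (cinner (T x) x))"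
proof -
  have "cnj (cinner (T x) x) = cinner (T x) x"
    using positive_operator_sym[OF assms] by (metis cinner_commute)
  then show ?thesis
    by (simp add: complex_eq_iff)
qed

lemma quadratic_form_deflate:
  "Re (cinner (deflate T x f) f) = Re (cinner (T f) f) - (cmod (cinner f (pivot T x)))\<^sup>2"
proof -
  have "cinner f (pivot T x) * cinner (pivot T x) f
      = complex_of_real ((cmod (cinner f (pivot T x)))\<^sup>2)"
    by (metis cinner_commute complex_norm_square)
  then show ?thesis
    by (simp add: deflate_def cinner_simps del: of_real_power)
qed

text \<open>
  For \<open>q > 0\<close>, where \<open>a = \<langle>f, T x\<rangle>\<close> and \<open>q = \<langle>T x, x\<rangle>\<close>,
  completing the square shows that the deflated form at
  \<open>f\<close> is the form of \<open>T\<close> at \<open>f - (a/q) x\<close>, which is nonnegative.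
\<close>

lemma positive_operator_deflate:
  assumes "positive_operator T"
  shows "positive_operator (deflate T x)"
  unfolding positive_operator_def
proof (intro conjI allI)
  note sym = positive_operator_sym[OF assms]
  show "cinner (deflate T x f) h = cinner f (deflate T x h)" for f h
    using cinner_commute[of h "pivot T x"]
    by (simp add: deflate_def cinner_simps sym)
  show "0 \<le> Re (cinner (deflate T x f) f)" for f
  proof (cases "Re (cinner (T x) x) = 0")
    case True
    then show ?thesis
      using positive_operator_nonneg[OF assms, of f]
      by (simp add: quadratic_form_deflate pivot_def cinner_simps)
  next
    case False
    define q where "q = Re (cinner (T x) x)"
    have q: "q > 0" and qx: "cinner x (T x) = complex_of_real q"
      using False positive_operator_nonneg[OF assms, of x] positive_operator_diag[OF assms, of x]
      by (auto simp: q_def sym)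
    define a where "a = cinner f (T x)"
    have a': "cinner x (T f) = cnj a"
      unfolding a_def by (metis cinner_commute sym)
    define y where "y = f - (a / complex_of_real q) *\<^sub>C x"
    have "cinner (T y) y = cinner y (T y)" by (rule sym)
    also have "\<dots> = cinner (T f) f - a * cnj a / complex_of_real q"
    proof -
      have "cinner y (T y) = cinner f (T y) - (a / complex_of_real q) * cinner x (T y)"
        by (simp add: y_def cinner_simps)
      also have "cinner f (T y) = cinner (T f) y" by (rule sym[symmetric])
      also have "\<dots> = cinner (T f) f - cnj (a / complex_of_real q) * cinner (T f) x"
        by (simp add: y_def cinner_simps)
      also have "cinner (T f) x = a" by (simp add: sym a_def)
      also have "cinner x (T y) = cinner (T x) y" by (rule sym[symmetric])
      also have "\<dots> = cinner (T x) f - cnj (a / complex_of_real q) * cinner (T x) x"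
        by (simp add: y_def cinner_simps)
      also have "cinner (T x) x = complex_of_real q" using qx by (simp add: sym)
      also have "cinner (T x) f = cnj a" using a' by (simp add: sym)
      finally show ?thesis using q by (simp add: field_simps)
    qed
    also have "a * cnj a / complex_of_real q = complex_of_real ((cmod a)\<^sup>2 / q)"
      by (simp add: complex_norm_square[symmetric])
    finally have "Re (cinner (T y) y) = Re (cinner (T f) f) - (cmod a)\<^sup>2 / q"
      by simp
    also have "(cmod a)\<^sup>2 / q = (cmod (cinner f (pivot T x)))\<^sup>2"
      using q by (simp add: pivot_def cinner_simps a_def q_def[symmetric] norm_mult
          norm_divide power_divide)
    finally show ?thesis
      using positive_operator_nonneg[OF assms, of y] by (simp add: quadratic_form_deflate)
  qed
qed

lemma deflate_annihilates:
  assumes "positive_operator T" and "Re (cinner (T x) x) \<noteq> 0"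
  shows "deflate T x x = 0"
proof -
  define q where "q = Re (cinner (T x) x)"
  have q: "q > 0" and qx: "cinner x (T x) = complex_of_real q"
    using assms positive_operator_nonneg[OF assms(1), of x] positive_operator_diag[OF assms(1), of x]
    by (auto simp: q_def positive_operator_sym[OF assms(1)])
  have "complex_of_real q = complex_of_real (sqrt q) * complex_of_real (sqrt q)"
    using q by (simp flip: of_real_mult)
  then have "cinner x (pivot T x) *\<^sub>C pivot T x = 1 *\<^sub>C T x"
    using q by (simp add: pivot_def cinner_simps q_def[symmetric] qx scaleC_scaleC)
  then show ?thesis by (simp add: deflate_def scaleC_one)
qed

lemma deflate_eq_0:
  assumes "positive_operator T" and "T y = 0"
  shows "deflate T x y = 0"
proof -
  have "cinner y (T x) = 0"
    using positive_operator_sym[OF assms(1), of y x] assms(2) by simp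
  then show ?thesis
    by (simp add: deflate_def pivot_def cinner_simps assms(2))
qed

text \<open>The remainders of the Cholesky algorithm with pivots taken along the sequence \<open>x\<close>.\<close>

primrec residual :: "('a::complex_inner \<Rightarrow> 'a) \<Rightarrow> (nat \<Rightarrow> 'a) \<Rightarrow> nat \<Rightarrow> 'a \<Rightarrow> 'a" where
  "residual T x 0 = T"
| "residual T x (Suc n) = deflate (residual T x n) (x n)"

text \<open>
  For the remainders \<open>R\<^sub>n\<close> the quadratic forms \<open>q\<^sub>n f = \<langle>R\<^sub>n f, f\<rangle>\<close> decrease in \<open>n\<close>, and \<open>q\<^sub>0 f - q\<^sub>n f\<close> is
  the \<open>n\<close>-th partial sum of \<open>|\<langle>f, g\<^sub>k\<rangle>|\<^sup>2\<close>.  As \<open>q\<^sub>n\<close> vanishes at \<open>x\<^sub>m\<close> for \<open>m < n\<close>, and all \<open>q\<^sub>n\<close> are bounded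
  by the same multiple of \<open>\<parallel>f\<parallel>\<^sup>2\<close>, density of the sequence gives \<open>q\<^sub>n f \<rightarrow> 0\<close>.
\<close>

theorem positive_operator_rank_one_decomposition:
  fixes T :: "'a::complex_inner \<Rightarrow> 'a"
  assumes "separable_space (euclidean :: 'a topology)"
    and "positive_operator T"
    and bounded: "\<And>f. Re (cinner (T f) f) \<le> M * (norm f)\<^sup>2"
  shows "\<exists>G. \<forall>f. ((\<lambda>g. (cmod (cinner f g))\<^sup>2) has_sum Re (cinner (T f) f)) G"
proof -
  obtain D :: "'a set" where D: "countable D" "closure D = UNIV"
    using assms(1) by (auto simp: separable_space_def)
  then have "D \<noteq> {}" by auto
  define x where "x = from_nat_into D"
  have range_x: "range x = D"
    unfolding x_def using D \<open>D \<noteq> {}\<close> by (simp add: range_from_nat_into)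
  define R where "R = residual T x"
  define q where "q n f = Re (cinner (R n f) f)" for n f
  define g where "g n = pivot (R n) (x n)" for n
  have pos: "positive_operator (R n)" for n
    by (induction n) (auto simp: R_def assms(2) positive_operator_deflate)
  have q_nonneg: "0 \<le> q n f" for n f
    unfolding q_def by (rule positive_operator_nonneg[OF pos])
  have q_Suc: "q (Suc n) f = q n f - (cmod (cinner f (g n)))\<^sup>2" for n f
    by (simp add: q_def g_def R_def quadratic_form_deflate)
  have q_sum: "(\<Sum>k<n. (cmod (cinner f (g k)))\<^sup>2) = q 0 f - q n f" for n f
    by (induction n) (simp_all add: q_Suc)
  have q_antimono: "q n f \<le> q m f" if "m \<le> n" for m n f
    using that by (induction rule: dec_induct) (auto simp: q_Suc intro: order_trans[rotated])
  have killed: "R n (x m) = 0" if "m < n" "q m (x m) \<noteq> 0" for m n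
    using Suc_leI[OF that(1)]
  proof (induction rule: dec_induct)
    case base
    show ?case
      using deflate_annihilates[OF pos, of m "x m"] that(2)
      by (simp add: R_def q_def)
  next
    case (step n)
    then show ?case
      using deflate_eq_0[OF pos] by (simp add: R_def)
  qed
  have q_dense: "q n (x m) = 0" if "m < n" for m n
  proof (cases "q m (x m) = 0")
    case True
    then show ?thesis
      using q_antimono[of m n "x m"] q_nonneg[of n "x m"] that by simp
  next
    case False
    then show ?thesis using killed[OF that] by (simp add: q_def)
  qed
  have q_parallelogram: "q n (u + v) \<le> 2 * q n u + 2 * q n v" for n u v
  proof -
    have "q n (u + v) + q n (u - v) = 2 * q n u + 2 * q n v"
      unfolding q_def by (simp add: cinner_simps positive_operator_sym[OF pos])
    then show ?thesis using q_nonneg[of n "u - v"] by simp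
  qed
  have q_lim: "(\<lambda>n. q n f) \<longlonglongrightarrow> 0" for f
  proof (rule LIMSEQ_I)
    fix e :: real assume "e > 0"
    \<comment> \<open>The bound \<open>M\<close> may be \<open>0\<close> (or negative, on the zero space), hence the maximum with \<open>1\<close>.\<close>
    define K where "K = max M 1"
    have "K > 0" by (simp add: K_def)
    define r where "r = sqrt (e / (2 * K))"
    have "r > 0" using \<open>e > 0\<close> \<open>K > 0\<close> by (simp add: r_def)
    have "f \<in> closure D" using D by simp
    then obtain m where m: "dist (x m) f < r"
      using \<open>r > 0\<close> range_x unfolding closure_approachable by (metis rangeE)
    have "norm (q n f - 0) < e" if "n \<ge> Suc m" for n
    proof -
      have "q n f \<le> 2 * q n (f - x m) + 2 * q n (x m)"
        using q_parallelogram[of n "f - x m" "x m"] by simp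
      also have "q n (x m) = 0" using q_dense that by simp
      also have "q n (f - x m) \<le> q 0 (f - x m)" by (rule q_antimono) simp
      also have "q 0 (f - x m) \<le> M * (norm (f - x m))\<^sup>2"
        using bounded by (simp add: q_def R_def)
      also have "\<dots> \<le> K * (norm (f - x m))\<^sup>2"
        by (intro mult_right_mono) (auto simp: K_def)
      finally have "q n f \<le> 2 * (K * (norm (f - x m))\<^sup>2)" by simp
      also have "(norm (f - x m))\<^sup>2 < r\<^sup>2"
        using m by (intro power_strict_mono) (auto simp: dist_norm norm_minus_commute)
      then have "2 * (K * (norm (f - x m))\<^sup>2) < 2 * (K * r\<^sup>2)"
        using \<open>K > 0\<close> by simp
      also have "2 * (K * r\<^sup>2) = e"
        using \<open>e > 0\<close> \<open>K > 0\<close> by (simp add: r_def)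
      finally show ?thesis using q_nonneg[of n f] by simp
    qed
    then show "\<exists>n0. \<forall>n\<ge>n0. norm (q n f - 0) < e" by blast
  qed
  \<comment> \<open>The steps whose pivot is nonzero; only these contribute to the decomposition.\<close>
  define N where "N = {n. q n (x n) \<noteq> 0}"
  have g_zero: "g n = 0" if "n \<notin> N" for n
    using that by (simp add: N_def g_def pivot_def q_def)
  have distinct: "g m \<noteq> g n" if "m < n" "m \<in> N" for m n
  proof -
    have "R n (x m) = 0" using killed that by (simp add: N_def)
    then have "cinner (x m) (g n) = 0"
      using positive_operator_sym[OF pos, of n "x m" "x n"]
      by (simp add: g_def pivot_def cinner_simps)
    moreover have "cinner (x m) (g m) \<noteq> 0"
      using that(2)
      by (auto simp: g_def pivot_def cinner_simps N_def q_def
          positive_operator_sym[OF pos, symmetric])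
    ultimately show ?thesis by auto
  qed
  have inj: "inj_on g N"
    by (rule linorder_inj_onI) (use distinct in auto)
  have "((\<lambda>h. (cmod (cinner f h))\<^sup>2) has_sum Re (cinner (T f) f)) (g ` N)" for f
  proof -
    have "(\<lambda>n. \<Sum>k<n. (cmod (cinner f (g k)))\<^sup>2) \<longlonglongrightarrow> q 0 f - 0"
      unfolding q_sum by (intro tendsto_intros q_lim)
    then have "(\<lambda>k. (cmod (cinner f (g k)))\<^sup>2) sums q 0 f"
      by (simp add: sums_def)
    then have "((\<lambda>k. (cmod (cinner f (g k)))\<^sup>2) has_sum q 0 f) UNIV"
      by (intro sums_nonneg_imp_has_sum) auto
    then have "((\<lambda>k. (cmod (cinner f (g k)))\<^sup>2) has_sum q 0 f) N"
      by (subst has_sum_cong_neutral[where T = UNIV and g = "\<lambda>k. (cmod (cinner f (g k)))\<^sup>2"])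
        (auto simp: g_zero)
    then show ?thesis
      using has_sum_reindex[OF inj, of "\<lambda>h. (cmod (cinner f h))\<^sup>2"]
      by (simp add: o_def q_def R_def)
  qed
  then show ?thesis by blast
qed

theorem theorem8:
  fixes A :: "'a::chilbert_space \<Rightarrow> 'a"
  assumes "separable_space (euclidean :: 'a topology)"
    and "bounded_clinear A"
    and "onorm A \<le> 1"
    and "\<And>f. (\<lambda>n. (cadjoint A ^^ n) f) \<longlonglongrightarrow> 0"
  shows "\<exists>G :: 'a set. tight_frame (G \<times> (UNIV :: nat set)) (\<lambda>(g, n). (A ^^ n) g)"
proof -
  define T where "T f = f - A (cadjoint A f)" for f
  note adj = cinner_cadjoint[OF assms(2)]
  have adj': "cinner x (A y) = cinner (cadjoint A x) y" for x y
    by (metis adj cinner_commute)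
  have form: "Re (cinner (T f) f) = (norm f)\<^sup>2 - (norm (cadjoint A f))\<^sup>2" for f
    by (simp add: T_def cinner_simps adj cinner_self)
  have "positive_operator T"
    unfolding positive_operator_def form
    by (auto simp: T_def cinner_simps adj adj' norm_cadjoint_le[OF assms(2,3)])
  moreover have "Re (cinner (T f) f) \<le> 1 * (norm f)\<^sup>2" for f
    by (simp add: form)
  ultimately obtain G where G:
    "\<And>f. ((\<lambda>g. (cmod (cinner f g))\<^sup>2) has_sum Re (cinner (T f) f)) G"
    using positive_operator_rank_one_decomposition[OF assms(1)] by metis
  have "((\<lambda>i. (cmod (cinner f (case i of (g, n) \<Rightarrow> (A ^^ n) g)))\<^sup>2) has_sum (norm f)\<^sup>2)
          (G \<times> (UNIV :: nat set))" for f
  proof -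
    define a where "a n = (norm ((cadjoint A ^^ n) f))\<^sup>2" for n
    have coeff: "cmod (cinner f ((A ^^ n) g)) = cmod (cinner ((cadjoint A ^^ n) f) g)" for n g
      by (metis cinner_funpow_cadjoint[OF assms(2)] cinner_commute complex_mod_cnj)
    have inner_sum: "((\<lambda>g. (cmod (cinner f ((A ^^ n) g)))\<^sup>2) has_sum (a n - a (Suc n))) G" for n
      unfolding coeff using G[of "(cadjoint A ^^ n) f"] by (simp add: form a_def)
    have "a \<longlonglongrightarrow> (norm (0::'a))\<^sup>2"
      unfolding a_def by (intro tendsto_intros assms(4))
    then have "(\<lambda>n. a n - a (Suc n)) sums (a 0 - 0)"
      by (intro telescope_sums') simp
    then have outer_sum: "((\<lambda>n. a n - a (Suc n)) has_sum (norm f)\<^sup>2) UNIV"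
      using norm_cadjoint_le[OF assms(2,3)]
      by (intro sums_nonneg_imp_has_sum) (auto simp: a_def power_mono)
    have "((\<lambda>(n, g). (cmod (cinner f ((A ^^ n) g)))\<^sup>2) has_sum (norm f)\<^sup>2) (UNIV \<times> G)"
    proof (rule has_sum_SigmaI[OF _ outer_sum])
      show "((\<lambda>g. case (n, g) of (n, g) \<Rightarrow> (cmod (cinner f ((A ^^ n) g)))\<^sup>2)
              has_sum (a n - a (Suc n))) G" for n
        using inner_sum by simp
      show "(\<lambda>(n, g). (cmod (cinner f ((A ^^ n) g)))\<^sup>2) summable_on (UNIV \<times> G)"
        using inner_sum outer_sum
        by (intro summable_on_SigmaI[where g = "\<lambda>n. a n - a (Suc n)"])
          (auto simp: summable_on_def)
    qed
    then show ?thesis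
      using has_sum_reindex[of prod.swap "G \<times> (UNIV :: nat set)"
          "\<lambda>(n, g). (cmod (cinner f ((A ^^ n) g)))\<^sup>2" "(norm f)\<^sup>2"]
      by (simp add: product_swap o_def case_prod_unfold)
  qed
  then have "tight_frame (G \<times> (UNIV :: nat set)) (\<lambda>(g, n). (A ^^ n) g)"
    unfolding tight_frame_def by (intro exI[of _ 1]) simp
  then show ?thesis by blast
qed

end
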